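(* Let $M=SO(p+q)/S(O(p)\times O(q))$ be the real Grassmann manifold, with $\mathfrak m\cong T_{o}M$ ($o$ the base point) identified with $\mathrm{Hom}(\mathbb R^q,\mathbb R^p)$, and let $\hat t\in\mathrm{End}(\mathfrak m)\otimes\mathrm{End}(\mathfrak m)$ be the Casimir element of $\mathfrak k=\mathfrak{so}(p)\times\mathfrak{so}(q)$ represented in $\mathfrak m$. For $n\in\{p,q\}$ let $$\mathcal R^n(\lambda,\mu)=\mathrm{id}+\frac{\hbar}{\lambda-\mu+\frac{n-2}{2}\hbar}\,\hat G_n+\frac{\hbar}{\lambda-\mu}\,\hat C_n,\qquad \hat G_n=-\sum_{i,j=1}^n E_{ij}\otimes E_{ij},\quad \hat C_n=\sum_{i,j=1}^n E_{ij}\otimes E_{ji}.$$ For arbitrary $v\in\mathfrak m\otimes\mathfrak m$ set $$\hat{\mathcal R}(\lambda,\mu)(v):=\mathcal R^p(\lambda,\mu)\,v\,\mathcal R^q(\lambda,\mu).$$ Then $\hat{\mathcal R}$ is a solution of the quantum Yang-Baxter equation $$\hat{\mathcal R}_{12}(\lambda_1,\lambda_2)\hat{\mathcal R}_{13}(\lambda_1,\lambda_3)\hat{\mathcal R}_{23}(\lambda_2,\lambda_3)=\hat{\mathcal R}_{23}(\lambda_2,\lambda_3)\hat{\mathcal R}_{13}(\lambda_1,\lambda_3)\hat{\mathcal R}_{12}(\lambda_1,\lambda_2)$$ on $\mathfrak m^{\otimes 3}$, and its power series expansion in $\hbar$ has the form $$\hat{\mathcal R}=\mathrm{id}+\frac{\hbar}{\lambda-\mu}\,\hat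 t+\frac{\hbar^2}{(\lambda-\mu)^2}\left(\frac12\hat t^{\,2}-\mathrm{id}\right)+O(\hbar^3).$$
   Context: Here $p,q\ge 1$ are integers, $\lambda,\mu,\lambda_1,\lambda_2,\lambda_3$ are spectral parameters, $\hbar$ is a formal deformation parameter (rational functions are expanded as power series in $\hbar$), and $E_{ij}$ denotes the elementary $n\times n$ matrix with $1$ in row $i$, column $j$ and $0$ elsewhere; $\mathcal R^n$ is an endomorphism of $\mathbb R^n\otimes\mathbb R^n$ (with coefficients extended to rational functions of the spectral parameters and power series in $\hbar$). The Lie algebra $\mathfrak g=\mathfrak{so}(p+q)$ splits as $\mathfrak k\oplus\mathfrak m$, where $\mathfrak k$ consists of the block diagonal matrices $\mathrm{diag}(A,D)$ with $A\in\mathfrak{so}(p)$, $D\in\mathfrak{so}(q)$, and $\mathfrak m$ of the matrices $\begin{pmatrix}0&B\\-B^T&0\end{pmatrix}$ with $B$ an arbitrary real $p\times q$ matrix, so $\mathfrak m\cong\mathrm{Hom}(\mathbb R^q,\mathbb R^p)$. The canonical representation of $\mathfrak k$ on $\mathfrak m$ is $\rho(A,D)(B)=AB-BD$. An element $v\in\mathfrak m\otimes\mathfrak m$ is viewed as a linear map $\mathbb R^q\otimes\mathbb R^q\to\mathbb R^p\otimes\mathbb R^p$, and $\mathcal R^p\,v\,\mathcal R^q$ is the composition of maps. Subscripts $12,13,23$ indicate on which factors of the threefold tensor product an operator acts. The Casimir element is $t=\sum_\alpha e_\alpha\otimes e^\alpha\in\mathfrak k\otimes\mathfrak k$ for dual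 bases of $\mathfrak k$ with respect to the invariant form $\langle(A,D),(A',D')\rangle=\frac12\mathrm{tr}(AA')+\frac12\mathrm{tr}(DD')$, and $\hat t=(\rho\otimes\rho)(t)$; with this normalization $\hat t(v)=(\hat C_p+\hat G_p)\,v+v\,(\hat C_q+\hat G_q)$. The square $\hat t^{\,2}$ is taken in the algebra $\mathrm{End}(\mathfrak m)\otimes\mathrm{End}(\mathfrak m)$. *)

theory Defs
  imports
    "HOL-Analysis.Analysis"
    "HOL-Computational_Algebra.Formal_Power_Series"
    "HOL-Computational_Algebra.Fraction_Field"
begin

section \<open>Coefficients\<close>

text \<open>
  Scalars are formal power series \<open>'k fps\<close> in the deformation parameter (\<open>fps_X\<close> is $\hbar$) over
  a field extension \<open>'k\<close> of the reals containing the spectral parameters. The class \<open>real_field\<close>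
  is just ``field and real algebra''. It contains the numerical parameter domains \<open>real\<close> and
  \<open>complex\<close>, and, by the instances below, the field of rational functions
  $\mathbb R(\lambda_1,\lambda_2,\lambda_3)$ = \<open>real poly poly poly fract\<close>, in which
  the spectral parameters are independent indeterminates.
\<close>

instantiation poly :: ("{comm_ring_1, real_algebra_1}") real_algebra_1
begin

definition scaleR_poly :: "real \<Rightarrow> 'a poly \<Rightarrow> 'a poly" where
  "scaleR_poly r p = smult (of_real r) p"

instance
  by standard
    (simp_all add: scaleR_poly_def smult_add_right smult_add_left)

end

instantiation fract :: ("{linordered_idom, real_algebra_1}") real_field
begin

definition scaleR_fract :: "real \<Rightarrow> 'a fract \<Rightarrow> 'a fract" where
  "scaleR_fract r x = Fract (of_real r) 1 * x"

instance
proof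
  fix a b :: real and x y :: "'a fract"
  have add: "Fract (of_real (a + b)) 1 = Fract (of_real a) 1 + (Fract (of_real b) 1 :: 'a fract)"
    by simp
  have mult: "Fract (of_real (a * b)) 1 = Fract (of_real a) 1 * (Fract (of_real b) 1 :: 'a fract)"
    by simp
  show "a *\<^sub>R (x + y) = a *\<^sub>R x + a *\<^sub>R y"
    by (simp add: scaleR_fract_def distrib_left)
  show "(a + b) *\<^sub>R x = a *\<^sub>R x + b *\<^sub>R x"
    unfolding scaleR_fract_def add by (rule distrib_right)
  show "a *\<^sub>R b *\<^sub>R x = (a * b) *\<^sub>R x"
    unfolding scaleR_fract_def mult by (simp add: mult.assoc)
  show "1 *\<^sub>R x = x"
    by (simp add: scaleR_fract_def One_fract_def [symmetric])
  show "a *\<^sub>R x * y = a *\<^sub>R (x * y)"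
    by (simp add: scaleR_fract_def mult.assoc)
  show "x * a *\<^sub>R y = a *\<^sub>R (x * y)"
    by (simp add: scaleR_fract_def mult.left_commute)
qed

end

definition embed_real :: "real \<Rightarrow> 'k::real_field fps" where
  "embed_real r = fps_const (of_real r)"


section \<open>Matrices and tensor products\<close>

text \<open>
  $\mathbb R^n$ is represented with a finite index type, and a tensor product of coordinate spaces is
  the coordinate space over the product of the index types. Thus $\mathfrak m$, identified with
  $\mathrm{Hom}(\mathbb R^q,\mathbb R^p)$, is \<open>real^'q^'p\<close>, and $\mathfrak m\otimes\mathfrak m$ and
  $\mathfrak m^{\otimes 3}$ are \<open>real^('q \<times> 'q)^('p \<times> 'p)\<close> and
  \<open>real^('q \<times> 'q \<times> 'q)^('p \<times> 'p \<times> 'p)\<close>, with the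
  Kronecker product as tensor product of elements. $\mathrm{End}(\mathfrak m)\otimes\mathrm{End}(\mathfrak m)$
  is $\mathrm{End}(\mathfrak m\otimes\mathfrak m)$, whose product is composition.
\<close>

definition elem_mat :: "'m::finite \<Rightarrow> 'n::finite \<Rightarrow> 'a::zero_neq_one ^ 'n ^ 'm" where
  "elem_mat i j = (\<chi> a b. if a = i \<and> b = j then 1 else 0)"

definition kron :: "'a::times ^ 'n ^ 'm \<Rightarrow> 'a ^ 'n2 ^ 'm2 \<Rightarrow> 'a ^ ('n::finite \<times> 'n2::finite) ^ ('m::finite \<times> 'm2::finite)"
  where "kron A B = (\<chi> x y. A $ fst x $ fst y * B $ snd x $ snd y)"

definition smul :: "'a::times \<Rightarrow> 'a ^ 'n ^ 'm \<Rightarrow> 'a ^ 'n ^ 'm" (infixr \<open>\<cdot>\<close> 75) where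
  "c \<cdot> v = map_matrix (\<lambda>x. c * x) v"

text \<open>The operator $f\otimes g$ on $\mathfrak m\otimes\mathfrak m$, for linear $f$ and $g$.\<close>

definition tensor_op ::
  "(real^'q^'p \<Rightarrow> real^'q^'p) \<Rightarrow> (real^'q^'p \<Rightarrow> real^'q^'p)
    \<Rightarrow> real^('q::finite \<times> 'q)^('p::finite \<times> 'p) \<Rightarrow> real^('q \<times> 'q)^('p \<times> 'p)" where
  "tensor_op f g v =
    (\<Sum>x\<in>UNIV. \<Sum>y\<in>UNIV. v $ x $ y *\<^sub>R
        kron (f (elem_mat (fst x) (fst y))) (g (elem_mat (snd x) (snd y))))"

text \<open>The extension of a real linear operator on $\mathfrak m\otimes\mathfrak m$ to coefficients \<open>'k fps\<close>.\<close>

definition extend_scalars ::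
  "(real^'b^'a \<Rightarrow> real^'b^'a) \<Rightarrow> 'k::real_field fps^'b::finite^'a::finite \<Rightarrow> 'k fps^'b^'a" where
  "extend_scalars T v =
    (\<Sum>x\<in>UNIV. \<Sum>y\<in>UNIV. v $ x $ y \<cdot> map_matrix embed_real (T (elem_mat x y)))"

text \<open>
  For an operator \<open>T\<close> on $\mathfrak m\otimes\mathfrak m$, the operators $T_{12}$, $T_{13}$, $T_{23}$ on
  $\mathfrak m^{\otimes 3}$: \<open>T\<close> is applied with the indices of the remaining factor held fixed.
\<close>

definition leg12 ::
  "('a^('q \<times> 'q)^('p \<times> 'p) \<Rightarrow> 'a^('q \<times> 'q)^('p \<times> 'p))
    \<Rightarrow> 'a^('q::finite \<times> 'q \<times> 'q)^('p::finite \<times> 'p \<times> 'p) \<Rightarrow> 'a^('q \<times> 'q \<times> 'q)^('p \<times> 'p \<times> 'p)" where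
  "leg12 T w = (\<chi> x y. case (x, y) of ((a, b, c), (i, j, k)) \<Rightarrow>
     T (\<chi> x' y'. w $ (fst x', snd x', c) $ (fst y', snd y', k)) $ (a, b) $ (i, j))"

definition leg13 ::
  "('a^('q \<times> 'q)^('p \<times> 'p) \<Rightarrow> 'a^('q \<times> 'q)^('p \<times> 'p))
    \<Rightarrow> 'a^('q::finite \<times> 'q \<times> 'q)^('p::finite \<times> 'p \<times> 'p) \<Rightarrow> 'a^('q \<times> 'q \<times> 'q)^('p \<times> 'p \<times> 'p)" where
  "leg13 T w = (\<chi> x y. case (x, y) of ((a, b, c), (i, j, k)) \<Rightarrow>
     T (\<chi> x' y'. w $ (fst x', b, snd x') $ (fst y', j, snd y')) $ (a, c) $ (i, k))"

definition leg23 ::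
  "('a^('q \<times> 'q)^('p \<times> 'p) \<Rightarrow> 'a^('q \<times> 'q)^('p \<times> 'p))
    \<Rightarrow> 'a^('q::finite \<times> 'q \<times> 'q)^('p::finite \<times> 'p \<times> 'p) \<Rightarrow> 'a^('q \<times> 'q \<times> 'q)^('p \<times> 'p \<times> 'p)" where
  "leg23 T w = (\<chi> x y. case (x, y) of ((a, b, c), (i, j, k)) \<Rightarrow>
     T (\<chi> x' y'. w $ (a, fst x', snd x') $ (i, fst y', snd y')) $ (b, c) $ (j, k))"

text \<open>
  $S = T + O(\hbar^N)$ for operators on a free module over \<open>'k fps\<close>: on every element, all
  components of the difference are divisible by $\hbar^N$.
\<close>

definition eq_mod_hbar ::
  "nat \<Rightarrow> ('k::real_field fps^'b^'a \<Rightarrow> 'k fps^'b^'a) \<Rightarrow> ('k fps^'b^'a \<Rightarrow> 'k fps^'b^'a) \<Rightarrow> bool" where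
  "eq_mod_hbar N S T \<longleftrightarrow> (\<forall>v x y. fps_X ^ N dvd (S v - T v) $ x $ y)"


section \<open>The symmetric pair of the real Grassmannian\<close>

definition so_alg :: "(real^'n^'n) set" where
  "so_alg = {X. transpose X = - X}"

text \<open>The element $\mathrm{diag}(A,D)$ of $\mathfrak k$ is represented by the pair \<open>(A, D)\<close>.\<close>

definition grass_k :: "((real^'p^'p) \<times> (real^'q^'q)) set" where
  "grass_k = so_alg \<times> so_alg"

definition k_form :: "(real^'p^'p) \<times> (real^'q^'q) \<Rightarrow> (real^'p^'p) \<times> (real^'q^'q) \<Rightarrow> real" where
  "k_form Y Z = trace (fst Y ** fst Z) / 2 + trace (snd Y ** snd Z) / 2"

definition rho :: "(real^'p^'p) \<times> (real^'q^'q) \<Rightarrow> real^'q^'p \<Rightarrow> real^'q^'p" where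
  "rho Y B = fst Y ** B - B ** snd Y"

text \<open>
  \<open>E\<close> is a basis of $\mathfrak k$, and \<open>d\<close> maps each basis element to the corresponding element of the
  dual basis.
\<close>

definition dual_bases_k ::
  "((real^'p^'p) \<times> (real^'q^'q)) set \<Rightarrow> ((real^'p^'p) \<times> (real^'q^'q) \<Rightarrow> (real^'p^'p) \<times> (real^'q^'q)) \<Rightarrow> bool" where
  "dual_bases_k E d \<longleftrightarrow> independent E \<and> span E = grass_k \<and> d ` E \<subseteq> grass_k \<and>
     (\<forall>e\<in>E. \<forall>e'\<in>E. k_form e (d e') = (if e = e' then 1 else 0))"

text \<open>$\hat t=(\rho\otimes\rho)(\sum_\alpha e_\alpha\otimes e^\alpha)$.\<close>

definition casimir_op ::
  "((real^'p^'p) \<times> (real^'q^'q)) set \<Rightarrow> ((real^'p^'p) \<times> (real^'q^'q) \<Rightarrow> (real^'p^'p) \<times> (real^'q^'q))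
    \<Rightarrow> real^('q::finite \<times> 'q)^('p::finite \<times> 'p) \<Rightarrow> real^('q \<times> 'q)^('p \<times> 'p)" where
  "casimir_op E d v = (\<Sum>e\<in>E. tensor_op (rho e) (rho (d e)) v)"


section \<open>The R-matrices\<close>

definition G_hat :: "'a::comm_ring_1 ^ ('n::finite \<times> 'n) ^ ('n \<times> 'n)" where
  "G_hat = - (\<Sum>i\<in>UNIV. \<Sum>j\<in>UNIV. kron (elem_mat i j) (elem_mat i j))"

definition C_hat :: "'a::comm_ring_1 ^ ('n::finite \<times> 'n) ^ ('n \<times> 'n)" where
  "C_hat = (\<Sum>i\<in>UNIV. \<Sum>j\<in>UNIV. kron (elem_mat i j) (elem_mat j i))"

text \<open>
  The denominators have constant term $\lambda-\mu$, so for $\lambda\neq\mu$ they are units and the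
  quotients are the power series expansions of the rational functions.
\<close>

definition R_mat :: "'k::real_field \<Rightarrow> 'k \<Rightarrow> 'k fps ^ ('n::finite \<times> 'n) ^ ('n \<times> 'n)" where
  "R_mat l m = mat 1
     + (fps_X / (fps_const (l - m) + fps_const ((of_nat CARD('n) - 2) / 2) * fps_X)) \<cdot> G_hat
     + (fps_X / fps_const (l - m)) \<cdot> C_hat"

definition R_hat ::
  "'k::real_field \<Rightarrow> 'k \<Rightarrow> 'k fps^('q::finite \<times> 'q)^('p::finite \<times> 'p) \<Rightarrow> 'k fps^('q \<times> 'q)^('p \<times> 'p)" where
  "R_hat l m v = R_mat l m ** v ** R_mat l m"


section \<open>Basic facts\<close>

lemma kron_sum_left: "kron (\<Sum>i\<in>I. A i) (B :: real^'b::finite^'a::finite) = (\<Sum>i\<in>I. kron (A i :: real^'d::finite^'c::finite) B)"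
  by (simp add: kron_def vec_eq_iff sum_distrib_right)

lemma kron_sum_right: "kron (A :: real^'d::finite^'c::finite) (\<Sum>i\<in>I. B i) = (\<Sum>i\<in>I. kron A (B i :: real^'b::finite^'a::finite))"
  by (simp add: kron_def vec_eq_iff sum_distrib_left)

lemma kron_scaleR: "kron (r *\<^sub>R A) (s *\<^sub>R B) = (r * s) *\<^sub>R kron A (B :: real^'b::finite^'a::finite)"
  for A :: "real^'d::finite^'c::finite"
  by (simp add: kron_def vec_eq_iff)

lemma mat_expand: "B = (\<Sum>x\<in>UNIV. \<Sum>y\<in>UNIV. B $ x $ y *\<^sub>R elem_mat x y)"
  for B :: "real^'b::finite^'a::finite"
proof -
  have "(\<Sum>x\<in>UNIV. \<Sum>y\<in>UNIV. B $ x $ y * (if i = x \<and> j = y then 1 else 0)) = B $ i $ j" for i j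
  proof -
    have "(\<Sum>y\<in>UNIV. B $ x $ y * (if i = x \<and> j = y then 1 else 0)) = (if i = x then B $ x $ j else 0)" for x
      by (cases "i = x") (simp_all add: if_distrib cong: if_cong)
    then show ?thesis by simp
  qed
  then show ?thesis
    by (simp add: vec_eq_iff elem_mat_def)
qed

lemma sum_UNIV_prod: "(\<Sum>x\<in>UNIV. f x) = (\<Sum>a\<in>UNIV. \<Sum>b\<in>UNIV. f (a, b))"
  for f :: "'a::finite \<times> 'b::finite \<Rightarrow> 'c::comm_monoid_add"
  by (simp add: sum.cartesian_product)

lemma tensor_op_kron:
  fixes A B :: "real^'q::finite^'p::finite"
  assumes f: "linear f" and g: "linear g"
  shows "tensor_op f g (kron A B) = kron (f A) (g B)"
proof -
  have fA: "f A = (\<Sum>x\<in>UNIV. \<Sum>y\<in>UNIV. A $ x $ y *\<^sub>R f (elem_mat x y))"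
    by (subst mat_expand[of A]) (simp add: linear_sum[OF f] linear_scale[OF f])
  have gB: "g B = (\<Sum>x\<in>UNIV. \<Sum>y\<in>UNIV. B $ x $ y *\<^sub>R g (elem_mat x y))"
    by (subst mat_expand[of B]) (simp add: linear_sum[OF g] linear_scale[OF g])
  have "kron (f A) (g B) = (\<Sum>x\<in>UNIV. \<Sum>y\<in>UNIV. A $ x $ y *\<^sub>R kron (f (elem_mat x y)) (g B))"
    by (simp add: fA kron_sum_left kron_scaleR[of _ _ 1, simplified])
  also have "\<dots> = (\<Sum>x\<in>UNIV. \<Sum>y\<in>UNIV. \<Sum>x'\<in>UNIV. \<Sum>y'\<in>UNIV.
      (A $ x $ y * B $ x' $ y') *\<^sub>R kron (f (elem_mat x y)) (g (elem_mat x' y')))"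
    by (simp add: gB kron_sum_right scaleR_sum_right kron_scaleR[of 1, simplified])
  also have "\<dots> = (\<Sum>x\<in>UNIV. \<Sum>x'\<in>UNIV. \<Sum>y\<in>UNIV. \<Sum>y'\<in>UNIV.
      (A $ x $ y * B $ x' $ y') *\<^sub>R kron (f (elem_mat x y)) (g (elem_mat x' y')))"
    by (intro sum.cong refl sum.swap)
  also have "\<dots> = tensor_op f g (kron A B)"
    by (simp add: tensor_op_def sum_UNIV_prod) (simp add: kron_def)
  finally show ?thesis ..
qed

text \<open>$T_{12}$ and its analogues act on pure tensors as expected.\<close>

lemma legs_kron:
  fixes A B C :: "'a::comm_ring_1^'q::finite^'p::finite"
  assumes T: "\<And>c v. T (c \<cdot> v) = c \<cdot> T v"
  shows "leg12 T (kron A (kron B C)) $ (a, b, c) $ (i, j, k) = T (kron A B) $ (a, b) $ (i, j) * C $ c $ k"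
    and "leg13 T (kron A (kron B C)) $ (a, b, c) $ (i, j, k) = T (kron A C) $ (a, c) $ (i, k) * B $ b $ j"
    and "leg23 T (kron A (kron B C)) $ (a, b, c) $ (i, j, k) = A $ a $ i * T (kron B C) $ (b, c) $ (j, k)"
proof -
  have "(\<chi> x' y'. kron A (kron B C) $ (fst x', snd x', c) $ (fst y', snd y', k)) = C $ c $ k \<cdot> kron A B"
    by (simp add: kron_def smul_def map_matrix_def vec_eq_iff mult_ac)
  then show "leg12 T (kron A (kron B C)) $ (a, b, c) $ (i, j, k) = T (kron A B) $ (a, b) $ (i, j) * C $ c $ k"
    by (simp add: leg12_def T) (simp add: smul_def map_matrix_def mult_ac)
  have "(\<chi> x' y'. kron A (kron B C) $ (fst x', b, snd x') $ (fst y', j, snd y')) = B $ b $ j \<cdot> kron A C"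
    by (simp add: kron_def smul_def map_matrix_def vec_eq_iff mult_ac)
  then show "leg13 T (kron A (kron B C)) $ (a, b, c) $ (i, j, k) = T (kron A C) $ (a, c) $ (i, k) * B $ b $ j"
    by (simp add: leg13_def T) (simp add: smul_def map_matrix_def mult_ac)
  have "(\<chi> x' y'. kron A (kron B C) $ (a, fst x', snd x') $ (i, fst y', snd y')) = A $ a $ i \<cdot> kron B C"
    by (simp add: kron_def smul_def map_matrix_def vec_eq_iff mult_ac)
  then show "leg23 T (kron A (kron B C)) $ (a, b, c) $ (i, j, k) = A $ a $ i * T (kron B C) $ (b, c) $ (j, k)"
    by (simp add: leg23_def T) (simp add: smul_def map_matrix_def mult_ac)
qed

lemma map_matrix_sum_embed:
  "map_matrix embed_real (\<Sum>i\<in>I. A i) = (\<Sum>i\<in>I. map_matrix embed_real (A i) :: 'k::real_field fps^'b::finite^'a::finite)"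
  by (induction I rule: infinite_finite_induct) (simp_all add: map_matrix_def vec_eq_iff embed_real_def flip: fps_const_add)

lemma extend_scalars_real:
  fixes v :: "real^'b::finite^'a::finite"
  assumes "linear T"
  shows "extend_scalars T (map_matrix embed_real v) = (map_matrix embed_real (T v) :: 'k::real_field fps^'b^'a)"
proof -
  have "T v = (\<Sum>x\<in>UNIV. \<Sum>y\<in>UNIV. v $ x $ y *\<^sub>R T (elem_mat x y))"
    by (subst mat_expand[of v]) (simp add: linear_sum[OF assms] linear_scale[OF assms])
  moreover have "map_matrix embed_real (r *\<^sub>R A) = (embed_real r \<cdot> map_matrix embed_real A :: 'k fps^'b^'a)" for r A
    by (simp add: map_matrix_def vec_eq_iff embed_real_def smul_def)
  ultimately have "map_matrix embed_real (T v) = (\<Sum>x\<in>UNIV. \<Sum>y\<in>UNIV.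
      embed_real (v $ x $ y) \<cdot> map_matrix embed_real (T (elem_mat x y)) :: 'k fps^'b^'a)"
    by (simp only: map_matrix_sum_embed)
  then show ?thesis
    by (simp add: extend_scalars_def map_matrix_def)
qed

lemma so_alg_iff: "X \<in> so_alg \<longleftrightarrow> (\<forall>i j. X $ j $ i = - X $ i $ j)"
  by (simp add: so_alg_def vec_eq_iff transpose_def)

lemma so_algD: "X \<in> so_alg \<Longrightarrow> X $ i $ j = - X $ j $ i"
  unfolding so_alg_iff by blast

lemma subspace_so_alg: "subspace (so_alg :: (real^'n::finite^'n) set)"
proof -
  have "transpose (0 :: real^'n^'n) = 0"
    "transpose (X + Z) = transpose X + transpose Z"
    "transpose (c *\<^sub>R X) = c *\<^sub>R transpose X" for X Z :: "real^'n^'n" and c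
    by (simp_all add: transpose_def vec_eq_iff)
  then show ?thesis
    by (simp add: subspace_def so_alg_def)
qed

lemma subspace_grass_k: "subspace (grass_k :: ((real^'p::finite^'p) \<times> (real^'q::finite^'q)) set)"
  unfolding grass_k_def by (intro subspace_Times subspace_so_alg)

text \<open>Dual bases exist, as the form is negative definite on $\mathfrak k$.\<close>

lemma ex_dual_bases_k:
  "\<exists>E d. dual_bases_k (E :: ((real^'p::finite^'p) \<times> (real^'q::finite^'q)) set) d"
proof -
  obtain E where E: "E \<subseteq> grass_k" "pairwise orthogonal E" "\<And>x. x \<in> E \<Longrightarrow> norm x = 1"
    "independent E" "card E = dim (grass_k :: ((real^'p^'p) \<times> (real^'q^'q)) set)" "span E = (grass_k :: ((real^'p^'p) \<times> (real^'q^'q)) set)"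
    by (rule orthonormal_basis_subspace[OF subspace_grass_k]) (rule that)
  have tr: "trace (A ** B) = - (A \<bullet> B)" if "A \<in> so_alg" for A B :: "real^'n::finite^'n"
  proof -
    have A: "A $ i $ j = - A $ j $ i" for i j
      using that by (rule so_algD)
    have "trace (A ** B) = (\<Sum>i\<in>UNIV. \<Sum>j\<in>UNIV. A $ i $ j * B $ j $ i)"
      by (simp add: trace_def matrix_matrix_mult_def)
    also have "\<dots> = (\<Sum>i\<in>UNIV. \<Sum>j\<in>UNIV. - (A $ j $ i * B $ j $ i))"
      by (intro sum.cong refl) (metis A mult_minus_left)
    also have "\<dots> = - (A \<bullet> B)"
      by (subst sum.swap) (simp add: inner_vec_def sum_negf)
    finally show ?thesis .
  qed
  have "k_form e ((-2) *\<^sub>R e') = (if e = e' then 1 else 0)" if "e \<in> E" "e' \<in> E" for e e'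
  proof -
    have so: "fst e \<in> so_alg" "snd e \<in> so_alg"
      using that E(1) by (auto simp: grass_k_def)
    have "k_form e ((-2) *\<^sub>R e') = e \<bullet> e'"
      by (simp add: k_form_def tr[OF so(1)] tr[OF so(2)] inner_prod_def)
    also have "\<dots> = (if e = e' then 1 else 0)"
      using that E(2,3) by (simp add: pairwise_def orthogonal_def norm_eq_1)
    finally show ?thesis .
  qed
  moreover have "(\<lambda>e. (-2) *\<^sub>R e) ` E \<subseteq> grass_k"
    using E(1) by (intro image_subsetI subspace_scale[OF subspace_grass_k]) blast
  ultimately have "dual_bases_k E (\<lambda>e. (-2) *\<^sub>R e)"
    unfolding dual_bases_k_def using E(4,6) by blast
  then show ?thesis by blast
qed

text \<open>
  The pairs and rectangular matrices above come from the decomposition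
  $\mathfrak{so}(p+q)=\mathfrak k\oplus\mathfrak m$ into block matrices, and \<open>rho\<close> is the
  commutator action of $\mathfrak k$ on $\mathfrak m$.
\<close>

definition k_block :: "(real^'p^'p) \<times> (real^'q^'q) \<Rightarrow> real^('p::finite + 'q::finite)^('p + 'q)" where
  "k_block Y = (\<chi> x y. case (x, y) of (Inl i, Inl j) \<Rightarrow> fst Y $ i $ j
     | (Inr i, Inr j) \<Rightarrow> snd Y $ i $ j | _ \<Rightarrow> 0)"

definition m_block :: "real^'q^'p \<Rightarrow> real^('p::finite + 'q::finite)^('p + 'q)" where
  "m_block B = (\<chi> x y. case (x, y) of (Inl i, Inr j) \<Rightarrow> B $ i $ j
     | (Inr i, Inl j) \<Rightarrow> - B $ j $ i | _ \<Rightarrow> 0)"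

lemma sum_UNIV_sum: "(\<Sum>x\<in>UNIV. f x) = (\<Sum>a\<in>UNIV. f (Inl a)) + (\<Sum>b\<in>UNIV. f (Inr b))"
  for f :: "'p::finite + 'q::finite \<Rightarrow> real"
  using sum.Plus[of UNIV UNIV f] by simp

lemma so_decomposition:
  fixes X :: "real^('p::finite + 'q::finite)^('p + 'q)"
  shows "X \<in> so_alg \<longleftrightarrow> (\<exists>!(Y, B). Y \<in> grass_k \<and> X = k_block Y + m_block B)"
proof
  assume X: "X \<in> so_alg"
  let ?Y = "((\<chi> i j. X $ Inl i $ Inl j) :: real^'p^'p, (\<chi> i j. X $ Inr i $ Inr j) :: real^'q^'q)"
  let ?B = "(\<chi> i j. X $ Inl i $ Inr j) :: real^'q^'p"
  show "\<exists>!(Y, B). Y \<in> grass_k \<and> X = k_block Y + m_block B"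
  proof (rule ex1I[of _ "(?Y, ?B)"])
    have "?Y \<in> grass_k"
      unfolding grass_k_def so_alg_iff by (auto simp: so_alg_iff intro: so_algD[OF X])
    moreover have "X = k_block ?Y + m_block ?B"
      using so_algD[OF X, of "Inr _" "Inl _"]
      by (simp add: k_block_def m_block_def vec_eq_iff split_sum_all)
    ultimately show "case (?Y, ?B) of (Y, B) \<Rightarrow> Y \<in> grass_k \<and> X = k_block Y + m_block B"
      by simp
  next
    fix z :: "((real^'p^'p) \<times> (real^'q^'q)) \<times> (real^'q^'p)"
    assume "case z of (Y, B) \<Rightarrow> Y \<in> grass_k \<and> X = k_block Y + m_block B"
    then have "X = k_block (fst z) + m_block (snd z)"
      by (simp add: case_prod_beta)
    then show "z = (?Y, ?B)"
      by (simp add: k_block_def m_block_def vec_eq_iff prod_eq_iff)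
  qed
next
  assume "\<exists>!(Y, B). Y \<in> grass_k \<and> X = k_block Y + m_block B"
  then obtain Y B where Y: "Y \<in> grass_k" and X: "X = k_block Y + m_block B" by auto
  have "fst Y $ i $ j + fst Y $ j $ i = 0" "snd Y $ k $ l + snd Y $ l $ k = 0" for i j k l
    using Y so_algD[of "fst Y" i j] so_algD[of "snd Y" k l] by (auto simp: grass_k_def)
  then have "X $ x $ y + X $ y $ x = 0" for x y
    unfolding X by (cases x; cases y) (simp_all add: k_block_def m_block_def)
  then show "X \<in> so_alg"
    unfolding so_alg_iff by (simp add: eq_neg_iff_add_eq_0)
qed

lemma commutator_k_m:
  fixes B :: "real^'q::finite^'p::finite"
  assumes "Y \<in> grass_k"
  shows "k_block Y ** m_block B - m_block B ** k_block Y = m_block (rho Y B)"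
proof -
  have Y: "fst Y $ i $ j = - fst Y $ j $ i" "snd Y $ k $ l = - snd Y $ l $ k" for i j k l
    using assms by (auto simp: grass_k_def intro: so_algD)
  have "(\<Sum>k\<in>UNIV. B $ k $ j * fst Y $ k $ i) = - (\<Sum>k\<in>UNIV. B $ k $ j * fst Y $ i $ k)" for i j
    by (subst Y(1)) (simp add: sum_negf)
  moreover have "(\<Sum>k\<in>UNIV. B $ i $ k * snd Y $ j $ k) = - (\<Sum>k\<in>UNIV. B $ i $ k * snd Y $ k $ j)" for i j
    by (subst Y(2)) (simp add: sum_negf)
  ultimately show ?thesis
    by (simp add: k_block_def m_block_def rho_def vec_eq_iff matrix_matrix_mult_def split_sum_all
        sum_UNIV_sum sum_negf mult.commute)
qed

end

theory Submission
  imports Defs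
begin

text \<open>
  Left multiplication by $\mathcal R^p$ and right multiplication by $\mathcal R^q$ commute, so the
  Yang--Baxter equation for $\hat{\mathcal R}$ splits into those for $\mathcal R^p$ and, in reversed
  order, $\mathcal R^q$. For $\mathcal R^n$, expand both sides in the Brauer diagrams on three
  strands: on each of the eight diagrams where they could differ, the difference of the coefficients
  vanishes by a partial fraction identity. The expansion in $\hbar$ rests on
  $\hat t(v)=(\hat C_p+\hat G_p)v+v(\hat C_q+\hat G_q)$ together with
  $(\hat C_n+\hat G_n)^2=\mathrm{id}-(n-2)\hat G_n$: the term $-\frac{n-2}{2}\hat G_n$ in
  $\frac12\hat t^{\,2}-\mathrm{id}$ is what the shift $\frac{n-2}{2}\hbar$ in the denominator
  of $\hat G_n$ produces.
\<close>

section \<open>Matrix entries\<close>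

text \<open>An opaque Kronecker delta in place of a conditional: products of deltas can be reordered
  as ring elements and summed away by \<open>sum_kd\<close>, without case splits.\<close>

definition kd :: "'n \<Rightarrow> 'n \<Rightarrow> 'a::comm_ring_1" where "kd i j = (if i = j then 1 else 0)"

lemma kd_refl [simp]: "kd i i = 1"
  by (simp add: kd_def)

lemma kd_commute: "kd i j = kd j i"
  by (simp add: kd_def)

lemma kd_Pair: "kd (a, b) (i, j) = kd a i * kd b j"
  by (simp add: kd_def)

lemma sum_kd:
  fixes f :: "'n::finite \<Rightarrow> 'a::comm_ring_1"
  shows "(\<Sum>s\<in>UNIV. kd s j * f s) = f j" "(\<Sum>s\<in>UNIV. kd j s * f s) = f j"
    and "(\<Sum>s\<in>UNIV. f s * kd s j) = f j" "(\<Sum>s\<in>UNIV. f s * kd j s) = f j"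
    and "(\<Sum>s\<in>UNIV. kd s j) = (1::'a)" "(\<Sum>s\<in>UNIV. kd j s) = (1::'a)"
  by (simp_all add: kd_def if_distrib[of "\<lambda>x. x * _"] if_distrib[of "\<lambda>x. _ * x"] cong: if_cong)

lemma sum_kd_factor: "(\<Sum>s\<in>S. kd i j * f s) = kd i j * (\<Sum>s\<in>S. f s)"
  by (simp add: sum_distrib_left)

lemma mat_1_nth: "mat 1 $ i $ j = kd i j"
  by (simp add: mat_def kd_def)

lemma elem_mat_nth: "elem_mat i j $ a $ b = kd a i * kd b j"
  by (simp add: elem_mat_def kd_def)

lemma G_hat_nth: "G_hat $ x $ y = - (kd (fst x) (snd x) * kd (fst y) (snd y))"
  by (simp add: G_hat_def kron_def elem_mat_nth mult_ac kd_commute sum_kd flip: sum_distrib_left)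

lemma C_hat_nth: "C_hat $ x $ y = kd (fst x) (snd y) * kd (snd x) (fst y)"
  by (simp add: C_hat_def kron_def elem_mat_nth mult_ac kd_commute sum_kd flip: sum_distrib_left)

text \<open>The matrix counterparts of the legs: \<open>A\<close> acts on two factors of the
  threefold tensor power of n-space, and the delta is the identity on the third.\<close>

definition mat12 :: "'a::comm_ring_1^('n::finite \<times> 'n)^('n \<times> 'n) \<Rightarrow> 'a^('n \<times> 'n \<times> 'n)^('n \<times> 'n \<times> 'n)" where
  "mat12 A = (\<chi> x y. case (x, y) of ((a, b, c), (i, j, k)) \<Rightarrow> A $ (a, b) $ (i, j) * kd c k)"

definition mat13 :: "'a::comm_ring_1^('n::finite \<times> 'n)^('n \<times> 'n) \<Rightarrow> 'a^('n \<times> 'n \<times> 'n)^('n \<times> 'n \<times> 'n)" where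
  "mat13 A = (\<chi> x y. case (x, y) of ((a, b, c), (i, j, k)) \<Rightarrow> A $ (a, c) $ (i, k) * kd b j)"

definition mat23 :: "'a::comm_ring_1^('n::finite \<times> 'n)^('n \<times> 'n) \<Rightarrow> 'a^('n \<times> 'n \<times> 'n)^('n \<times> 'n \<times> 'n)" where
  "mat23 A = (\<chi> x y. case (x, y) of ((a, b, c), (i, j, k)) \<Rightarrow> A $ (b, c) $ (j, k) * kd a i)"

text \<open>A leg freezes one row index and one column index of \<open>w\<close>. Left
  multiplication sees only rows and right multiplication only columns, so freezing amounts to an
  identity factor on each side separately.\<close>

lemma leg_sandwich:
  fixes A :: "'a::comm_ring_1^('p::finite \<times> 'p)^('p \<times> 'p)" and B :: "'a^('q::finite \<times> 'q)^('q \<times> 'q)"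
  shows "leg12 (\<lambda>v. A ** v ** B) w = mat12 A ** w ** mat12 B"
    and "leg13 (\<lambda>v. A ** v ** B) w = mat13 A ** w ** mat13 B"
    and "leg23 (\<lambda>v. A ** v ** B) w = mat23 A ** w ** mat23 B"
  by (simp_all add: vec_eq_iff leg12_def leg13_def leg23_def mat12_def mat13_def mat23_def
      matrix_matrix_mult_def sum_UNIV_prod sum_distrib_left sum_distrib_right,
      simp_all add: mult_ac sum_kd sum_kd_factor)

section \<open>The Yang--Baxter equation\<close>

text \<open>The operators are \<open>id + a G + b C\<close> on two of three indices, with the sign
  of G written out.\<close>

lemma R_operators_ybe:
  fixes w :: "'n::finite \<Rightarrow> 'n \<Rightarrow> 'n \<Rightarrow> 'a::comm_ring_1"
  defines "T12 \<equiv> \<lambda>b a w x y z. w x y z + b * w y x z - a * kd x y * (\<Sum>s\<in>UNIV. w s s z)"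
   and "T13 \<equiv> \<lambda>b a w x y z. w x y z + b * w z y x - a * kd x z * (\<Sum>s\<in>UNIV. w s y s)"
   and "T23 \<equiv> \<lambda>b a w x y z. w x y z + b * w x z y - a * kd y z * (\<Sum>s\<in>UNIV. w x s s)"
  assumes R1: "b12 * b23 = b12 * b13 + b13 * b23"
    and R2: "a12 * b23 = a12 * a13 + a13 * b23"
    and R3: "b12 * a23 = b12 * a13 + a13 * a23"
    and R4: "a12 * b13 * (1 + b23) + b13 * a23 * (1 + b12) + a12 * a13 * a23 =
               a12 * a23 * (1 + of_nat CARD('n) * b13) + b12 * a13 * b23"
  shows "T12 b12 a12 (T13 b13 a13 (T23 b23 a23 w)) x y z = T23 b23 a23 (T13 b13 a13 (T12 b12 a12 w)) x y z"
proof -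
  \<comment> \<open>Each of the four coefficient differences multiplies two Brauer diagrams with
    opposite signs. The factor \<open>of_nat CARD('n)\<close> comes from G12 C13 G23 and G23 C13
    G12: the transposition aligns the two contractions, which closes a loop.\<close>
  have "T12 b12 a12 (T13 b13 a13 (T23 b23 a23 w)) x y z - T23 b23 a23 (T13 b13 a13 (T12 b12 a12 w)) x y z =
     (b12 * b13 + b13 * b23 - b12 * b23) * (w z x y - w y z x)
     + (a12 * a13 + a13 * b23 - a12 * b23) * (kd x y * (\<Sum>s\<in>UNIV. w s z s) - kd x z * (\<Sum>s\<in>UNIV. w s s y))
     + (b12 * a13 + a13 * a23 - b12 * a23) * (kd x z * (\<Sum>s\<in>UNIV. w y s s) - kd y z * (\<Sum>s\<in>UNIV. w s x s))
     + (a12 * b13 * (1 + b23) + b13 * a23 * (1 + b12) + a12 * a13 * a23 -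
         (a12 * a23 * (1 + of_nat CARD('n) * b13) + b12 * a13 * b23)) *
       (kd y z * (\<Sum>s\<in>UNIV. w s s x) - kd x y * (\<Sum>s\<in>UNIV. w z s s))"
    unfolding T12_def T13_def T23_def
    by (simp add: algebra_simps sum.distrib sum_subtractf sum_kd kd_commute flip: sum_distrib_left)
  then show ?thesis
    by (simp add: R1 R2 R3 R4)
qed

text \<open>This is \<open>1/(\<alpha> \<beta>) = (1/\<alpha> + 1/\<beta>)/(\<alpha> +
  \<beta>)\<close>, cleared of denominators because power series form a domain and not a
  field.\<close>

lemma reciprocal_sum_identity:
  fixes h :: "'a::idom"
  assumes "x * \<alpha> = h" "y * \<beta> = h" "z * (\<alpha> + \<beta>) = h"
    and "\<alpha> \<noteq> 0" "\<beta> \<noteq> 0" "\<alpha> + \<beta> \<noteq> 0"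
  shows "x * y = x * z + z * y"
proof -
  have "(\<alpha> * \<beta> * (\<alpha> + \<beta>)) * (x * y) = (x * \<alpha>) * (y * \<beta>) * (\<alpha> + \<beta>)"
    by (simp only: mult_ac)
  also have "\<dots> = (x * \<alpha>) * (z * (\<alpha> + \<beta>)) * \<beta> + (z * (\<alpha> + \<beta>)) * (y * \<beta>) * \<alpha>"
    unfolding assms(1-3) by (simp add: algebra_simps)
  also have "\<dots> = (\<alpha> * \<beta> * (\<alpha> + \<beta>)) * (x * z + z * y)"
    by (simp add: algebra_simps)
  finally show ?thesis
    using assms(4-6) by simp
qed

text \<open>Here \<open>u\<close> and \<open>v\<close> stand for the differences of consecutive
  spectral parameters. The first three identities hold for any shift \<open>k\<close>, since in each
  the two denominators on the left add up to the third one; only the last fixes \<open>k\<close> as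
  half of \<open>n - 2\<close>.\<close>

lemma R_coefficient_identities:
  fixes h :: "'a::idom"
  assumes b: "b12 * u = h" "b23 * v = h" "b13 * (u + v) = h"
    and a: "a12 * (u + k * h) = h" "a23 * (v + k * h) = h" "a13 * (u + v + k * h) = h"
    and nz: "u \<noteq> 0" "v \<noteq> 0" "u + v \<noteq> 0" "u + k * h \<noteq> 0" "v + k * h \<noteq> 0" "u + v + k * h \<noteq> 0"
    and k: "2 * k = n - 2"
  shows "b12 * b23 = b12 * b13 + b13 * b23"
    and "a12 * b23 = a12 * a13 + a13 * b23"
    and "b12 * a23 = b12 * a13 + a13 * a23"
    and "a12 * b13 * (1 + b23) + b13 * a23 * (1 + b12) + a12 * a13 * a23 =
           a12 * a23 * (1 + n * b13) + b12 * a13 * b23"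
proof -
  show 1: "b12 * b23 = b12 * b13 + b13 * b23"
    using b nz by (intro reciprocal_sum_identity)
  show 2: "a12 * b23 = a12 * a13 + a13 * b23"
    using a b nz by (intro reciprocal_sum_identity[of _ "u + k * h" h _ v]) (simp_all add: add_ac)
  show 3: "b12 * a23 = b12 * a13 + a13 * a23"
    using a b nz by (intro reciprocal_sum_identity[of _ u h _ "v + k * h"]) (simp_all add: add_ac)
  let ?U = "u + k * h" and ?V = "v + k * h" and ?S = "u + v + k * h"
  \<comment> \<open>The shifts add up: \<open>?U + ?V = (u + v) + 2 * k * h\<close>.\<close>
  have "(?U * ?V * (u + v)) * (a12 * b13 + b13 * a23) =
      (a12 * ?U) * (b13 * (u + v)) * ?V + (b13 * (u + v)) * (a23 * ?V) * ?U"
    by (simp add: algebra_simps)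
  also have "\<dots> = h * h * (u + v) + 2 * k * h * h * h"
    unfolding a b by (simp add: algebra_simps)
  also have "\<dots> = (a12 * ?U) * (a23 * ?V) * (u + v) + 2 * k * (a12 * ?U) * (a23 * ?V) * (b13 * (u + v))"
    unfolding a b ..
  also have "\<dots> = (?U * ?V * (u + v)) * (a12 * a23 + 2 * k * a12 * a23 * b13)"
    by (simp add: algebra_simps)
  finally have 4: "a12 * b13 + b13 * a23 = a12 * a23 + 2 * k * a12 * a23 * b13"
    using nz by simp
  \<comment> \<open>This time the point is \<open>?U + ?V + (u + v) = 2 * ?S\<close>.\<close>
  have "(?U * ?V * (u + v) * ?S) * (b13 * a13 * (a12 + a23) + a12 * a13 * a23) =
      (b13 * (u + v)) * (a13 * ?S) * (a12 * ?U) * ?V + (b13 * (u + v)) * (a13 * ?S) * (a23 * ?V) * ?U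
      + (a12 * ?U) * (a13 * ?S) * (a23 * ?V) * (u + v)"
    by (simp add: algebra_simps)
  also have "\<dots> = 2 * (h * h * h * ?S)"
    unfolding a b by (simp add: algebra_simps)
  also have "\<dots> = 2 * ((a12 * ?U) * (a23 * ?V) * (b13 * (u + v)) * ?S)"
    unfolding a b ..
  also have "\<dots> = (?U * ?V * (u + v) * ?S) * (2 * a12 * a23 * b13)"
    by (simp only: mult_ac)
  finally have 5: "b13 * a13 * (a12 + a23) + a12 * a13 * a23 = 2 * a12 * a23 * b13"
    using nz by simp
  \<comment> \<open>By 1, 2 and 3,
    \<open>a12 * b13 * b23 + b13 * a23 * b12 - b12 * a13 * b23\<close> equals
    \<open>b13 * a13 * (a12 + a23)\<close>. What remains is the sum of 4 and 5, whose terms in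
    \<open>a12 * a23 * b13\<close> combine to the factor \<open>2 * k + 2\<close>.\<close>
  have "n = 2 * k + 2"
    using k by simp
  then show "a12 * b13 * (1 + b23) + b13 * a23 * (1 + b12) + a12 * a13 * a23 =
      a12 * a23 * (1 + n * b13) + b12 * a13 * b23"
    using 1 2 3 4 5 by algebra
qed

text \<open>Identifies the matrices with the operators of \<open>R_operators_ybe\<close>. The
  argument order differs: \<open>R\<close> takes the coefficient of G first, those operators take
  that of C first.\<close>

lemma ybe_mat_mult_vec:
  fixes w :: "'a::comm_ring_1^('n::finite \<times> 'n \<times> 'n)"
  defines "R a b \<equiv> mat 1 + a \<cdot> G_hat + b \<cdot> C_hat"
  shows "(mat12 (R a b) *v w) $ (x, y, z) =
           w $ (x, y, z) + b * w $ (y, x, z) - a * kd x y * (\<Sum>s\<in>UNIV. w $ (s, s, z))"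
    and "(mat13 (R a b) *v w) $ (x, y, z) =
           w $ (x, y, z) + b * w $ (z, y, x) - a * kd x z * (\<Sum>s\<in>UNIV. w $ (s, y, s))"
    and "(mat23 (R a b) *v w) $ (x, y, z) =
           w $ (x, y, z) + b * w $ (x, z, y) - a * kd y z * (\<Sum>s\<in>UNIV. w $ (x, s, s))"
proof -
  have R: "R a b $ (i, j) $ (k, l) = kd i k * kd j l + b * (kd i l * kd j k) - a * (kd i j * kd k l)" for i j k l
    by (simp add: R_def smul_def map_matrix_def G_hat_nth C_hat_nth mat_def kd_def)
  show "(mat12 (R a b) *v w) $ (x, y, z) =
           w $ (x, y, z) + b * w $ (y, x, z) - a * kd x y * (\<Sum>s\<in>UNIV. w $ (s, s, z))"
    and "(mat13 (R a b) *v w) $ (x, y, z) =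
           w $ (x, y, z) + b * w $ (z, y, x) - a * kd x z * (\<Sum>s\<in>UNIV. w $ (s, y, s))"
    and "(mat23 (R a b) *v w) $ (x, y, z) =
           w $ (x, y, z) + b * w $ (x, z, y) - a * kd y z * (\<Sum>s\<in>UNIV. w $ (x, s, s))"
    by (simp_all add: matrix_vector_mult_def mat12_def mat13_def mat23_def sum_UNIV_prod R
        algebra_simps kd_commute sum.distrib sum_subtractf sum_kd flip: sum_distrib_left)
qed

section \<open>From the scalar identities to the Yang-Baxter equation for matrices\<close>

lemma matrix_ybe:
  fixes a12 b12 a13 b13 a23 b23 :: "'a::comm_ring_1"
  defines "R a b \<equiv> (mat 1 + a \<cdot> G_hat + b \<cdot> C_hat :: 'a^('n::finite \<times> 'n)^('n \<times> 'n))"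
  assumes "b12 * b23 = b12 * b13 + b13 * b23"
    and "a12 * b23 = a12 * a13 + a13 * b23"
    and "b12 * a23 = b12 * a13 + a13 * a23"
    and "a12 * b13 * (1 + b23) + b13 * a23 * (1 + b12) + a12 * a13 * a23 =
           a12 * a23 * (1 + of_nat CARD('n) * b13) + b12 * a13 * b23"
  shows "mat12 (R a12 b12) ** mat13 (R a13 b13) ** mat23 (R a23 b23) =
         mat23 (R a23 b23) ** mat13 (R a13 b13) ** mat12 (R a12 b12)"
proof -
  have "(mat12 (R a12 b12) *v (mat13 (R a13 b13) *v (mat23 (R a23 b23) *v w))) $ (x, y, z) =
      (mat23 (R a23 b23) *v (mat13 (R a13 b13) *v (mat12 (R a12 b12) *v w))) $ (x, y, z)" for w x y z
    unfolding R_def ybe_mat_mult_vec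
    by (rule R_operators_ybe[OF assms(2-5), of "\<lambda>x y z. w $ (x, y, z)"])
  then show ?thesis
    unfolding matrix_eq vec_eq_iff split_paired_All
    by (simp only: matrix_vector_mul_assoc matrix_mul_assoc) simp
qed

lemma R_mat_ybe:
  fixes l1 l2 l3 :: "'k::real_field"
  assumes "l1 \<noteq> l2" "l1 \<noteq> l3" "l2 \<noteq> l3"
  shows "mat12 (R_mat l1 l2) ** mat13 (R_mat l1 l3) ** mat23 (R_mat l2 l3) =
    (mat23 (R_mat l2 l3) ** mat13 (R_mat l1 l3) ** mat12 (R_mat l1 l2)
       :: 'k fps ^ ('n::finite \<times> 'n \<times> 'n) ^ ('n \<times> 'n \<times> 'n))"
proof -
  define \<kappa> :: 'k where "\<kappa> = (of_nat CARD('n) - 2) / 2"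
  \<comment> \<open>Both denominators have constant term \<open>c\<close>, hence are invertible
    power series, and the quotients satisfy the product equations that
    \<open>R_coefficient_identities\<close> takes as hypotheses.\<close>
  have unit: "fps_const c + fps_const \<kappa> * fps_X \<noteq> 0"
    "fps_X / (fps_const c + fps_const \<kappa> * fps_X) * (fps_const c + fps_const \<kappa> * fps_X) = fps_X"
    "fps_const c \<noteq> 0" "fps_X / fps_const c * fps_const c = fps_X" if "c \<noteq> 0" for c
  proof -
    have *: "fps_nth (fps_const c + fps_const \<kappa> * fps_X) 0 \<noteq> 0" "fps_nth (fps_const c) 0 \<noteq> 0"
      using that by simp_all
    then show "fps_const c + fps_const \<kappa> * fps_X \<noteq> 0" "fps_const c \<noteq> 0" by auto
    show "fps_X / (fps_const c + fps_const \<kappa> * fps_X) * (fps_const c + fps_const \<kappa> * fps_X) = fps_X"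
      "fps_X / fps_const c * fps_const c = fps_X"
      using * by (simp_all add: fps_divide_unit mult.assoc inverse_mult_eq_1)
  qed
  have l: "fps_const (l1 - l3) = fps_const (l1 - l2) + fps_const (l2 - l3)"
    by simp
  have nz: "l1 - l2 \<noteq> 0" "l2 - l3 \<noteq> 0" "l1 - l3 \<noteq> 0"
    using assms by auto
  have "2 * \<kappa> = of_nat CARD('n) - 2"
    by (simp add: \<kappa>_def)
  then have \<kappa>: "2 * fps_const \<kappa> = of_nat CARD('n) - 2"
    by (metis fps_const_mult fps_const_sub fps_numeral_fps_const fps_of_nat)
  show ?thesis
    unfolding R_mat_def \<kappa>_def[symmetric] l
    by (rule matrix_ybe; rule R_coefficient_identities[OF
          unit(4)[OF nz(1)] unit(4)[OF nz(2)] unit(4)[OF nz(3), unfolded l]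
          unit(2)[OF nz(1)] unit(2)[OF nz(2)] unit(2)[OF nz(3), unfolded l]
          unit(3)[OF nz(1)] unit(3)[OF nz(2)] unit(3)[OF nz(3), unfolded l]
          unit(1)[OF nz(1)] unit(1)[OF nz(2)] unit(1)[OF nz(3), unfolded l] \<kappa>])
qed

lemma R_hat_ybe:
  fixes l1 l2 l3 :: "'k::real_field"
  assumes "l1 \<noteq> l2" "l1 \<noteq> l3" "l2 \<noteq> l3"
  shows "leg12 (R_hat l1 l2) \<circ> leg13 (R_hat l1 l3) \<circ> leg23 (R_hat l2 l3) =
        (leg23 (R_hat l2 l3) \<circ> leg13 (R_hat l1 l3) \<circ> leg12 (R_hat l1 l2)
          :: 'k fps^('q::finite \<times> 'q \<times> 'q)^('p::finite \<times> 'p \<times> 'p) \<Rightarrow> 'k fps^('q \<times> 'q \<times> 'q)^('p \<times> 'p \<times> 'p))"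
proof
  fix w :: "'k fps^('q \<times> 'q \<times> 'q)^('p \<times> 'p \<times> 'p)"
  have "leg12 (R_hat l1 l2) (leg13 (R_hat l1 l3) (leg23 (R_hat l2 l3) w)) =
     (mat12 (R_mat l1 l2) ** mat13 (R_mat l1 l3) ** mat23 (R_mat l2 l3)) ** w **
     (mat23 (R_mat l2 l3) ** mat13 (R_mat l1 l3) ** mat12 (R_mat l1 l2))"
    unfolding R_hat_def[abs_def] leg_sandwich by (simp only: matrix_mul_assoc)
  \<comment> \<open>The equation is used twice, for p on the left of \<open>w\<close> and for q on
    the right, where composition has reversed the order of the factors.\<close>
  also have "\<dots> = (mat23 (R_mat l2 l3) ** mat13 (R_mat l1 l3) ** mat12 (R_mat l1 l2)) ** w **
     (mat12 (R_mat l1 l2) ** mat13 (R_mat l1 l3) ** mat23 (R_mat l2 l3))"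
    by (simp only: R_mat_ybe[OF assms])
  also have "\<dots> = leg23 (R_hat l2 l3) (leg13 (R_hat l1 l3) (leg12 (R_hat l1 l2) w))"
    unfolding R_hat_def[abs_def] leg_sandwich by (simp only: matrix_mul_assoc)
  finally show "(leg12 (R_hat l1 l2) \<circ> leg13 (R_hat l1 l3) \<circ> leg23 (R_hat l2 l3)) w =
     (leg23 (R_hat l2 l3) \<circ> leg13 (R_hat l1 l3) \<circ> leg12 (R_hat l1 l2)) w"
    by simp
qed

section \<open>The Casimir element\<close>

lemma k_form_sum:
  "k_form Y Z = (\<Sum>i\<in>UNIV. \<Sum>j\<in>UNIV. fst Y $ i $ j * fst Z $ j $ i) / 2
     + (\<Sum>i\<in>UNIV. \<Sum>j\<in>UNIV. snd Y $ i $ j * snd Z $ j $ i) / 2"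
  by (simp add: k_form_def trace_def matrix_matrix_mult_def)

lemma linear_k_form: "linear (\<lambda>Y. k_form Y Z)"
  by (rule linearI) (simp_all add: k_form_sum algebra_simps sum.distrib add_divide_distrib sum_distrib_left)

text \<open>Pairing with \<open>d e'\<close> picks out the coefficient at \<open>e'\<close> of an
  expansion in \<open>E\<close>.\<close>

lemma dual_bases_k_expand:
  assumes "dual_bases_k E d" "Z \<in> grass_k"
  shows "(\<Sum>e\<in>E. k_form Z (d e) *\<^sub>R e) = Z"
proof -
  have "finite E"
    using assms by (auto simp: dual_bases_k_def intro: independent_imp_finite)
  moreover have "Z \<in> span E"
    using assms by (simp add: dual_bases_k_def)
  ultimately obtain c where c: "Z = (\<Sum>e\<in>E. c e *\<^sub>R e)"
    by (auto simp: span_finite)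
  have "k_form Z (d e') = c e'" if "e' \<in> E" for e'
  proof -
    have "k_form Z (d e') = (\<Sum>e\<in>E. c e * k_form e (d e'))"
      unfolding c linear_sum[OF linear_k_form] linear_scale[OF linear_k_form] by simp
    also have "\<dots> = (\<Sum>e\<in>E. c e * (if e = e' then 1 else 0))"
      using assms(1) that by (intro sum.cong refl) (auto simp: dual_bases_k_def)
    also have "\<dots> = c e'"
      using \<open>finite E\<close> that by (simp add: if_distrib[of "\<lambda>x. _ * x"] cong: if_cong)
    finally show ?thesis .
  qed
  then show ?thesis
    by (simp add: c)
qed

text \<open>On skew matrices an entry is itself a pairing: half the trace of
  \<open>(elem_mat j i - elem_mat i j) ** D\<close> is half of \<open>D $ i $ j - D $ j $ i\<close>,
  which is \<open>D $ i $ j\<close>. Expanding in the basis then removes every trace of the choice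
  of \<open>E\<close> and \<open>d\<close>.\<close>

lemma
  fixes E :: "((real^'p::finite^'p) \<times> (real^'q::finite^'q)) set"
  assumes E: "dual_bases_k E d"
  shows sum_dual_fst: "(\<Sum>e\<in>E. fst (d e) $ i $ j *\<^sub>R e) = (elem_mat j i - elem_mat i j, 0)"
    and sum_dual_snd: "(\<Sum>e\<in>E. snd (d e) $ k $ l *\<^sub>R e) = (0, elem_mat l k - elem_mat k l)"
proof -
  have d: "fst (d e) $ j $ i = - fst (d e) $ i $ j" "snd (d e) $ l $ k = - snd (d e) $ k $ l" if "e \<in> E" for e
  proof -
    have "d e \<in> grass_k"
      using E that by (auto simp: dual_bases_k_def)
    then show "fst (d e) $ j $ i = - fst (d e) $ i $ j" "snd (d e) $ l $ k = - snd (d e) $ k $ l"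
      by (auto simp: grass_k_def intro: so_algD)
  qed
  have mem: "(elem_mat j i - elem_mat i j, 0) \<in> (grass_k :: ((real^'p^'p) \<times> (real^'q^'q)) set)"
      "(0, elem_mat l k - elem_mat k l) \<in> (grass_k :: ((real^'p^'p) \<times> (real^'q^'q)) set)"
    by (simp_all add: grass_k_def so_alg_iff elem_mat_nth)
  have "k_form (elem_mat j i - elem_mat i j, 0) (d e) = fst (d e) $ i $ j"
     "k_form (0, elem_mat l k - elem_mat k l) (d e) = snd (d e) $ k $ l" if "e \<in> E" for e
    using d[OF that] by (simp_all add: k_form_sum elem_mat_nth algebra_simps sum_subtractf sum_kd flip: sum_distrib_left)
  then have "(\<Sum>e\<in>E. fst (d e) $ i $ j *\<^sub>R e) = (\<Sum>e\<in>E. k_form (elem_mat j i - elem_mat i j, 0) (d e) *\<^sub>R e)"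
    "(\<Sum>e\<in>E. snd (d e) $ k $ l *\<^sub>R e) = (\<Sum>e\<in>E. k_form (0, elem_mat l k - elem_mat k l) (d e) *\<^sub>R e)"
    by simp_all
  then show "(\<Sum>e\<in>E. fst (d e) $ i $ j *\<^sub>R e) = (elem_mat j i - elem_mat i j, 0)"
    and "(\<Sum>e\<in>E. snd (d e) $ k $ l *\<^sub>R e) = (0, elem_mat l k - elem_mat k l)"
    using mem by (simp_all add: dual_bases_k_expand[OF E])
qed

section \<open>The Casimir element as left and right multiplication\<close>

lemma rho_elem_mat_nth:
  "rho Y (elem_mat s t) $ a $ i = fst Y $ a $ s * kd t i - kd a s * snd Y $ t $ i"
  by (simp add: rho_def matrix_matrix_mult_def elem_mat_nth mult_ac kd_commute sum_kd sum_kd_factor)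

lemma casimir_tensor:
  fixes E :: "((real^'p::finite^'p) \<times> (real^'q::finite^'q)) set"
  assumes E: "dual_bases_k E d"
  shows "(\<Sum>e\<in>E. rho e (elem_mat s t) $ a $ i * rho (d e) (elem_mat s' t') $ b $ j) =
    (G_hat + C_hat) $ (a, b) $ (s, s') * (kd t i * kd t' j)
      + kd a s * kd b s' * (G_hat + C_hat) $ (t, t') $ (i, j)"
proof -
  have "(\<Sum>e\<in>E. fst e $ a $ s * fst (d e) $ b $ s') = (G_hat + C_hat) $ (a, b) $ (s, s')"
    using arg_cong[OF sum_dual_fst[OF E, of b s'], of "\<lambda>Z. fst Z $ a $ s"]
    by (simp add: fst_sum elem_mat_nth G_hat_nth C_hat_nth kd_commute mult_ac)
  \<comment> \<open>The mixed sums vanish because the elements found in \<open>sum_dual_fst\<close>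
    and \<open>sum_dual_snd\<close> each lie in a single block.\<close>
  moreover have "(\<Sum>e\<in>E. snd e $ t $ i * fst (d e) $ b $ s') = 0"
    using arg_cong[OF sum_dual_fst[OF E, of b s'], of "\<lambda>Z. snd Z $ t $ i"]
    by (simp add: snd_sum mult_ac)
  moreover have "(\<Sum>e\<in>E. fst e $ a $ s * snd (d e) $ t' $ j) = 0"
    using arg_cong[OF sum_dual_snd[OF E, of t' j], of "\<lambda>Z. fst Z $ a $ s"]
    by (simp add: fst_sum mult_ac)
  moreover have "(\<Sum>e\<in>E. snd e $ t $ i * snd (d e) $ t' $ j) = (G_hat + C_hat) $ (t, t') $ (i, j)"
    using arg_cong[OF sum_dual_snd[OF E, of t' j], of "\<lambda>Z. snd Z $ t $ i"]
    by (simp add: snd_sum elem_mat_nth G_hat_nth C_hat_nth kd_commute mult_ac)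
  moreover have "(\<Sum>e\<in>E. rho e (elem_mat s t) $ a $ i * rho (d e) (elem_mat s' t') $ b $ j) =
     (\<Sum>e\<in>E. fst e $ a $ s * fst (d e) $ b $ s') * (kd t i * kd t' j)
     - (\<Sum>e\<in>E. snd e $ t $ i * fst (d e) $ b $ s') * (kd a s * kd t' j)
     - (\<Sum>e\<in>E. fst e $ a $ s * snd (d e) $ t' $ j) * (kd t i * kd b s')
     + kd a s * kd b s' * (\<Sum>e\<in>E. snd e $ t $ i * snd (d e) $ t' $ j)"
    by (simp add: rho_elem_mat_nth algebra_simps sum.distrib sum_subtractf sum_distrib_left)
  ultimately show ?thesis
    by simp
qed

text \<open>Both sides are linear in \<open>v\<close>, and \<open>casimir_tensor\<close> supplies
  the coefficient of each entry of \<open>v\<close>.\<close>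

lemma casimir_op_eq:
  fixes E :: "((real^'p::finite^'p) \<times> (real^'q::finite^'q)) set"
  assumes E: "dual_bases_k E d"
  shows "casimir_op E d v = (G_hat + C_hat) ** v + v ** (G_hat + C_hat)"
proof -
  have "casimir_op E d v $ (a, b) $ (i, j) = ((G_hat + C_hat) ** v + v ** (G_hat + C_hat)) $ (a, b) $ (i, j)" for a b i j
  proof -
    have "casimir_op E d v $ (a, b) $ (i, j) = (\<Sum>e\<in>E. \<Sum>x\<in>UNIV. \<Sum>y\<in>UNIV. v $ x $ y *
        (rho e (elem_mat (fst x) (fst y)) $ a $ i * rho (d e) (elem_mat (snd x) (snd y)) $ b $ j))"
      by (simp add: casimir_op_def tensor_op_def kron_def)
    also have "\<dots> = (\<Sum>x\<in>UNIV. \<Sum>y\<in>UNIV. v $ x $ y *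
        (\<Sum>e\<in>E. rho e (elem_mat (fst x) (fst y)) $ a $ i * rho (d e) (elem_mat (snd x) (snd y)) $ b $ j))"
      by (subst sum.swap, intro sum.cong refl, subst sum.swap) (simp add: sum_distrib_left)
    also have "\<dots> = ((G_hat + C_hat) ** v + v ** (G_hat + C_hat)) $ (a, b) $ (i, j)"
      unfolding casimir_tensor[OF E] matrix_matrix_mult_def
      by (simp add: sum_UNIV_prod distrib_left sum.distrib sum_kd kd_commute mult_ac
          del: vector_add_component flip: sum_distrib_left) simp
    finally show ?thesis .
  qed
  then show ?thesis
    by (simp add: vec_eq_iff)
qed

text \<open>The Brauer relations behind this are C C = id, C G = G C = G and G G = -n G, the last
  because G is minus a contraction that closes a loop.\<close>

lemma GC_square:
  "(G_hat + C_hat) ** (G_hat + C_hat) =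
    (mat 1 + (2 - of_nat CARD('n)) \<cdot> G_hat :: 'a::comm_ring_1^('n::finite \<times> 'n)^('n \<times> 'n))"
  by (simp add: vec_eq_iff matrix_matrix_mult_def sum_UNIV_prod G_hat_nth C_hat_nth smul_def map_matrix_def
      mat_1_nth kd_Pair algebra_simps sum.distrib sum_subtractf sum_kd kd_commute flip: sum_distrib_left)

lemma matrix_mul_elem_mat:
  "(A ** elem_mat x y) $ i $ j = A $ i $ x * kd y j"
  "(elem_mat x y ** B) $ i $ j = kd i x * B $ y $ j"
  "(A ** elem_mat x y ** B) $ i $ j = A $ i $ x * B $ y $ j"
  by (simp_all add: matrix_matrix_mult_def elem_mat_nth mult_ac kd_commute sum_kd sum_kd_factor)

lemma matrix_add_rdistrib: "(A + B) ** C = A ** C + B ** C"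
  by (simp add: matrix_matrix_mult_def vec_eq_iff distrib_right sum.distrib)

text \<open>Left and right multiplication commute, so the square consists of two squares and twice a
  mixed term. Each square contributes one copy of \<open>u\<close> by \<open>GC_square\<close>; half
  of the two copies cancels against the subtracted \<open>u\<close>.\<close>

lemma casimir_op_square:
  fixes E :: "((real^'p::finite^'p) \<times> (real^'q::finite^'q)) set"
  assumes E: "dual_bases_k E d"
  shows "(1/2) *\<^sub>R (casimir_op E d \<circ> casimir_op E d) u - u =
    (G_hat + C_hat) ** u ** (G_hat + C_hat)
      - ((of_nat CARD('p) - 2) / 2) *\<^sub>R (G_hat ** u)
      - ((of_nat CARD('q) - 2) / 2) *\<^sub>R (u ** G_hat)"
proof -
  have smul: "c \<cdot> A = c *\<^sub>R A" for c and A :: "real^'b^'a"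
    by (simp add: smul_def map_matrix_def vec_eq_iff)
  have double: "M ** (M ** u + u ** N) + (M ** u + u ** N) ** N
      = (M ** M) ** u + 2 *\<^sub>R (M ** u ** N) + u ** (N ** N)" for M N
    by (simp add: matrix_add_ldistrib matrix_add_rdistrib matrix_mul_assoc scaleR_2)
  have "(casimir_op E d \<circ> casimir_op E d) u =
      ((G_hat + C_hat) ** (G_hat + C_hat)) ** u + 2 *\<^sub>R ((G_hat + C_hat) ** u ** (G_hat + C_hat))
        + u ** ((G_hat + C_hat) ** (G_hat + C_hat))"
    by (simp only: comp_apply casimir_op_eq[OF E] double)
  also have "\<dots> = 2 *\<^sub>R u + (2 - of_nat CARD('p)) *\<^sub>R (G_hat ** u)
      + 2 *\<^sub>R ((G_hat + C_hat) ** u ** (G_hat + C_hat)) + (2 - of_nat CARD('q)) *\<^sub>R (u ** G_hat)"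
    unfolding GC_square smul
    by (simp add: matrix_add_ldistrib[of u] matrix_add_rdistrib[of _ _ u] matrix_scalar_ac scaleR_2 flip: scalar_matrix_assoc)
  finally have square: "(casimir_op E d \<circ> casimir_op E d) u = 2 *\<^sub>R u + (2 - of_nat CARD('p)) *\<^sub>R (G_hat ** u)
      + 2 *\<^sub>R ((G_hat + C_hat) ** u ** (G_hat + C_hat)) + (2 - of_nat CARD('q)) *\<^sub>R (u ** G_hat)" .
  show ?thesis
    unfolding square by (simp add: vec_eq_iff field_simps)
qed

section \<open>The expansion in the deformation parameter\<close>

lemma extend_scalars_nth:
  "extend_scalars T v $ i $ j = (\<Sum>x\<in>UNIV. \<Sum>y\<in>UNIV. v $ x $ y * embed_real (T (elem_mat x y) $ i $ j))"
  by (simp add: extend_scalars_def smul_def map_matrix_def)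

lemma embed_real_simps:
  "embed_real (a + b) = embed_real a + embed_real b" "embed_real (a - b) = embed_real a - embed_real b"
  "embed_real (a * b) = embed_real a * embed_real b"
  "embed_real (kd x y) = kd x y" "embed_real (G_hat $ i $ j) = G_hat $ i $ j" "embed_real (C_hat $ i $ j) = C_hat $ i $ j"
  by (simp_all add: embed_real_def kd_def G_hat_nth C_hat_nth)

text \<open>The scalar form of the expansion: \<open>\<delta>\<close>, \<open>g\<close>,
  \<open>c\<close> are entries of the identity, G and C for p, the primed letters those for q, and
  \<open>x\<close> is the first-order parameter.\<close>

lemma R_product_expansion:
  fixes h :: "'a::comm_ring_1"
  assumes x: "x = h * y" and a: "a = x - k * x\<^sup>2 + h ^ 3 * r" and a': "a' = x - k' * x\<^sup>2 + h ^ 3 * r'"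
  shows "h ^ 3 dvd (\<delta> + a * g + x * c) * (\<delta>' + a' * g' + x * c') -
     (\<delta> * \<delta>' + x * ((g + c) * \<delta>' + \<delta> * (g' + c'))
      + x\<^sup>2 * ((g + c) * (g' + c') - k * (g * \<delta>') - k' * (\<delta> * g')))"
proof (rule dvdI)
  \<comment> \<open>The two factors modulo \<open>h ^ 3\<close>. In the cofactor below,
    \<open>r\<close> and \<open>r'\<close> collect their remainders, and the \<open>y ^ 3\<close>
    part holds the terms of \<open>?S * ?S'\<close> with at least three factors
    \<open>x\<close>.\<close>
  let ?S = "\<delta> + x * (g + c) - k * x\<^sup>2 * g" and ?S' = "\<delta>' + x * (g' + c') - k' * x\<^sup>2 * g'"
  show "(\<delta> + a * g + x * c) * (\<delta>' + a' * g' + x * c') -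
     (\<delta> * \<delta>' + x * ((g + c) * \<delta>' + \<delta> * (g' + c'))
      + x\<^sup>2 * ((g + c) * (g' + c') - k * (g * \<delta>') - k' * (\<delta> * g'))) =
     h ^ 3 * (r * g * ?S' + ?S * (r' * g') + h ^ 3 * r * r' * g * g'
       - y ^ 3 * (k * g * (g' + c') + k' * (g + c) * g' - x * k * k' * g * g'))"
    unfolding a a' x by (simp add: algebra_simps power2_eq_square power3_eq_cube)
qed

lemma G_coefficient_expansion:
  fixes u k :: "'k::field"
  assumes "u \<noteq> 0"
  defines "x \<equiv> fps_X / fps_const u"
  shows "\<exists>r. fps_X / (fps_const u + fps_const k * fps_X) = x - fps_const k * x\<^sup>2 + fps_X ^ 3 * r"
proof -
  let ?a = "fps_X / (fps_const u + fps_const k * fps_X)"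
  have *: "fps_nth (fps_const u + fps_const k * fps_X) 0 \<noteq> 0"
    using assms by simp
  then have a: "?a = fps_X * inverse (fps_const u + fps_const k * fps_X)"
    by (simp add: fps_divide_unit)
  have x: "x = fps_X * fps_const (inverse u)"
    by (simp add: x_def mult.commute)
  have ux: "fps_const u * x = fps_X"
    unfolding x using assms(1) by (simp add: mult.left_commute)
  have "fps_const u * (?a + fps_const k * x * ?a) = ?a * (fps_const u + fps_const k * (fps_const u * x))"
    by (simp add: algebra_simps)
  also have "\<dots> = fps_X"
    unfolding ux a using * by (simp add: mult.assoc inverse_mult_eq_1)
  also have "\<dots> = fps_const u * x"
    by (simp add: ux)
  finally have "?a + fps_const k * x * ?a = x"
    using assms(1) by (subst (asm) mult_left_cancel) simp_all
  then have "?a = x - fps_const k * x * ?a"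
    by (simp only: eq_diff_eq)
  \<comment> \<open>The geometric series is obtained by inserting the fixed-point equation into
    itself once. The remainder \<open>k^2 x^2 ?a\<close> carries three factors \<open>fps_X\<close>,
    one of them from \<open>?a\<close>.\<close>
  then have "?a = x - fps_const k * x * (x - fps_const k * x * ?a)"
    by metis
  also have "\<dots> = x - fps_const k * x\<^sup>2 + fps_X ^ 3 *
      ((fps_const k)\<^sup>2 * (fps_const (inverse u))\<^sup>2 * inverse (fps_const u + fps_const k * fps_X))"
    unfolding a x by (simp add: algebra_simps power2_eq_square power3_eq_cube)
  finally show ?thesis
    by blast
qed

text \<open>All operators involved are linear in \<open>v\<close>, so it suffices to compare the
  coefficients of each entry \<open>v $ s $ s'\<close>; there the claim is
  \<open>R_product_expansion\<close>.\<close>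

lemma R_hat_expansion:
  fixes E :: "((real^'p::finite^'p) \<times> (real^'q::finite^'q)) set" and l m :: "'k::real_field"
  assumes E: "dual_bases_k E d" and "l \<noteq> m"
  defines "t \<equiv> casimir_op E d"
  shows "eq_mod_hbar 3 (R_hat l m)
          (\<lambda>v :: 'k fps^('q \<times> 'q)^('p \<times> 'p).
              v + (fps_X / fps_const (l - m)) \<cdot> extend_scalars t v
                + (fps_X\<^sup>2 / fps_const ((l - m)\<^sup>2))
                    \<cdot> extend_scalars (\<lambda>u. (1/2) *\<^sub>R (t \<circ> t) u - u) v)"
  unfolding eq_mod_hbar_def
proof (intro allI)
  fix v :: "'k fps^('q \<times> 'q)^('p \<times> 'p)" and i :: "'p \<times> 'p" and j :: "'q \<times> 'q"
  define x :: "'k fps" where "x = fps_X / fps_const (l - m)"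
  define kp kq :: 'k where "kp = (of_nat CARD('p) - 2) / 2" and "kq = (of_nat CARD('q) - 2) / 2"
  define ap aq where "ap = fps_X / (fps_const (l - m) + fps_const kp * fps_X)"
    and "aq = fps_X / (fps_const (l - m) + fps_const kq * fps_X)"
  have u: "l - m \<noteq> 0"
    using assms by simp
  have x1: "x = fps_X * fps_const (inverse (l - m))"
    by (simp add: x_def mult.commute)
  have x2: "fps_X\<^sup>2 / fps_const ((l - m)\<^sup>2) = x\<^sup>2"
    by (simp add: x1 power_mult_distrib power_inverse mult.commute)
  obtain rp rq where r: "ap = x - fps_const kp * x\<^sup>2 + fps_X ^ 3 * rp" "aq = x - fps_const kq * x\<^sup>2 + fps_X ^ 3 * rq"
    using G_coefficient_expansion[OF u] unfolding ap_def aq_def x_def by metis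
  \<comment> \<open>Elementary matrices suffice, since \<open>extend_scalars\<close> evaluates an
    operator only on them.\<close>
  have t1: "t (elem_mat s s') $ i $ j = (G_hat $ i $ s + C_hat $ i $ s) * kd s' j + kd i s * (G_hat $ s' $ j + C_hat $ s' $ j)" for s s'
    by (simp add: t_def casimir_op_eq[OF E] matrix_mul_elem_mat)
  have t2: "((1/2) *\<^sub>R (t \<circ> t) (elem_mat s s') - elem_mat s s') $ i $ j =
      (G_hat $ i $ s + C_hat $ i $ s) * (G_hat $ s' $ j + C_hat $ s' $ j)
       - (of_nat CARD('p) - 2) / 2 * (G_hat $ i $ s * kd s' j) - (of_nat CARD('q) - 2) / 2 * (kd i s * G_hat $ s' $ j)" for s s'
    unfolding t_def casimir_op_square[OF E] by (simp add: matrix_mul_elem_mat)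
  have emb: "embed_real ((of_nat CARD('p) - 2) / 2) = fps_const kp" "embed_real ((of_nat CARD('q) - 2) / 2) = fps_const kq"
    by (simp_all add: embed_real_def kp_def kq_def)
  have R: "R_hat l m v $ i $ j = (\<Sum>s\<in>UNIV. \<Sum>s'\<in>UNIV. v $ s $ s' *
      ((kd i s + ap * G_hat $ i $ s + x * C_hat $ i $ s) * (kd s' j + aq * G_hat $ s' $ j + x * C_hat $ s' $ j)))"
    unfolding R_hat_def R_mat_def kp_def[symmetric] kq_def[symmetric] ap_def[symmetric] aq_def[symmetric] x_def[symmetric]
    by (simp add: matrix_matrix_mult_def smul_def map_matrix_def mat_1_nth sum_distrib_left mult_ac)
      (rule sum.swap)
  have v: "v $ i $ j = (\<Sum>s\<in>UNIV. \<Sum>s'\<in>UNIV. v $ s $ s' * (kd i s * kd s' j))"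
    by (simp add: mult_ac sum_kd sum_kd_factor)
  have S1: "(x \<cdot> extend_scalars t v) $ i $ j = (\<Sum>s\<in>UNIV. \<Sum>s'\<in>UNIV. v $ s $ s' *
      (x * ((G_hat $ i $ s + C_hat $ i $ s) * kd s' j + kd i s * (G_hat $ s' $ j + C_hat $ s' $ j))))"
    by (simp add: smul_def map_matrix_def extend_scalars_nth t1 embed_real_simps sum_distrib_left mult_ac)
  have S2: "(x\<^sup>2 \<cdot> extend_scalars (\<lambda>u. (1/2) *\<^sub>R (t \<circ> t) u - u) v) $ i $ j =
    (\<Sum>s\<in>UNIV. \<Sum>s'\<in>UNIV. v $ s $ s' *
      (x\<^sup>2 * ((G_hat $ i $ s + C_hat $ i $ s) * (G_hat $ s' $ j + C_hat $ s' $ j)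
            - fps_const kp * (G_hat $ i $ s * kd s' j) - fps_const kq * (kd i s * G_hat $ s' $ j))))"
    unfolding smul_def map_matrix_def vec_lambda_beta extend_scalars_nth t2 embed_real_simps emb
    by (simp only: sum_distrib_left mult.left_commute[of "x\<^sup>2"])
  have "(R_hat l m v - (v + x \<cdot> extend_scalars t v
      + x\<^sup>2 \<cdot> extend_scalars (\<lambda>u. (1/2) *\<^sub>R (t \<circ> t) u - u) v)) $ i $ j =
    (\<Sum>s\<in>UNIV. \<Sum>s'\<in>UNIV. v $ s $ s' *
      ((kd i s + ap * G_hat $ i $ s + x * C_hat $ i $ s) * (kd s' j + aq * G_hat $ s' $ j + x * C_hat $ s' $ j)
       - (kd i s * kd s' j + x * ((G_hat $ i $ s + C_hat $ i $ s) * kd s' j + kd i s * (G_hat $ s' $ j + C_hat $ s' $ j))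
         + x\<^sup>2 * ((G_hat $ i $ s + C_hat $ i $ s) * (G_hat $ s' $ j + C_hat $ s' $ j)
            - fps_const kp * (G_hat $ i $ s * kd s' j) - fps_const kq * (kd i s * G_hat $ s' $ j)))))"
    \<comment> \<open>The double sum is split into the separate expansions, and \<open>R\<close> and
      \<open>v\<close> are folded back from right to left.\<close>
    unfolding right_diff_distrib[of "v $ _ $ _"] distrib_left[of "v $ _ $ _"] sum_subtractf sum.distrib R[symmetric] v[symmetric]
    by (simp only: vector_minus_component vector_add_component S1 S2)
  also have "fps_X ^ 3 dvd \<dots>"
    by (intro dvd_sum dvd_mult R_product_expansion[OF x1 r])
  finally show "fps_X ^ 3 dvd (R_hat l m v - (v + (fps_X / fps_const (l - m)) \<cdot> extend_scalars t v
      + (fps_X\<^sup>2 / fps_const ((l - m)\<^sup>2)) \<cdot> extend_scalars (\<lambda>u. (1/2) *\<^sub>R (t \<circ> t) u - u) v)) $ i $ j"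
    unfolding x2 x_def[symmetric] .
qed

theorem theorem4p1:
  fixes E :: "((real^'p::finite^'p) \<times> (real^'q::finite^'q)) set"
    and d :: "(real^'p^'p) \<times> (real^'q^'q) \<Rightarrow> (real^'p^'p) \<times> (real^'q^'q)"
    and t_hat :: "real^('q \<times> 'q)^('p \<times> 'p) \<Rightarrow> real^('q \<times> 'q)^('p \<times> 'p)"
  assumes "dual_bases_k E d"
    and "t_hat = casimir_op E d"
  shows
    "(\<forall>l1 l2 l3 :: 'k::real_field. l1 \<noteq> l2 \<and> l1 \<noteq> l3 \<and> l2 \<noteq> l3 \<longrightarrow>
        leg12 (R_hat l1 l2) \<circ> leg13 (R_hat l1 l3) \<circ> leg23 (R_hat l2 l3) =
        (leg23 (R_hat l2 l3) \<circ> leg13 (R_hat l1 l3) \<circ> leg12 (R_hat l1 l2)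
          :: 'k fps^('q \<times> 'q \<times> 'q)^('p \<times> 'p \<times> 'p) \<Rightarrow> 'k fps^('q \<times> 'q \<times> 'q)^('p \<times> 'p \<times> 'p)))
     \<and> (\<forall>l m :: 'k. l \<noteq> m \<longrightarrow>
        eq_mod_hbar 3 (R_hat l m)
          (\<lambda>v :: 'k fps^('q \<times> 'q)^('p \<times> 'p).
              v + (fps_X / fps_const (l - m)) \<cdot> extend_scalars t_hat v
                + (fps_X\<^sup>2 / fps_const ((l - m)\<^sup>2))
                    \<cdot> extend_scalars (\<lambda>u. (1/2) *\<^sub>R (t_hat \<circ> t_hat) u - u) v))"
  unfolding assms(2) using R_hat_ybe R_hat_expansion[OF assms(1)] by blast

end
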